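(* Let $G$ be a chordal graph of maximum degree $\Delta$. Then $\chi_{\rm pcf}(G)\le 2\Delta+1$.
   Context: All graphs are simple, finite and undirected. A vertex coloring of a graph is proper if adjacent vertices get distinct colors. It is conflict-free (with respect to open neighborhoods) if for every non-isolated vertex $x$ there is a color that appears exactly once on the open neighborhood $N(x)$. A PCF $k$-coloring is a vertex coloring with at most $k$ colors that is both proper and conflict-free. The PCF chromatic number $\chi_{\rm pcf}(G)$ is the minimum $k$ for which $G$ admits a PCF $k$-coloring. A graph is chordal if it has no induced cycle of length at least $4$. *)

theory Defs
  imports "Graph_Theory.Digraph_Component"
begin

text \<open>
  A finite simple undirected graph is a term \<open>G\<close> satisfying the predicate \<^const>\<open>graph\<close> of
  Graph\_Theory: a finite, symmetric, loop-free digraph without parallel arcs. Each undirected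
  edge is represented by its two opposite arcs.
\<close>

definition open_nbhd :: "('a, 'b) pre_digraph \<Rightarrow> 'a \<Rightarrow> 'a set" where
  "open_nbhd G x = {y. x \<rightarrow>\<^bsub>G\<^esub> y}"

text \<open>
  Since every edge at \<open>v\<close> contributes exactly one arc leaving \<open>v\<close>, the degree of \<open>v\<close> is its
  out-degree. The element 0 only matters for the graph without vertices.
\<close>

definition max_degree :: "('a, 'b) pre_digraph \<Rightarrow> nat" where
  "max_degree G = Max (insert 0 (out_degree G ` verts G))"

text \<open>
  The cycle is given by its list of arcs, so \<open>length p\<close> is its length, and each of its vertices is
  the tail of exactly one arc of \<open>p\<close>. The library's cycles include the back-and-forth
  walks of length 2, which are not cycles of an undirected graph; they are harmless here because
  \<open>chordal\<close> only looks at length at least 4.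
\<close>

definition induced_cycle :: "('a, 'b) pre_digraph \<Rightarrow> 'b list \<Rightarrow> bool" where
  "induced_cycle G p \<longleftrightarrow> pre_digraph.cycle G p \<and>
     (\<forall>e \<in> arcs (G \<restriction> (tail G ` set p)).
        \<exists>e' \<in> set p. {tail G e, head G e} = {tail G e', head G e'})"

definition chordal :: "('a, 'b) pre_digraph \<Rightarrow> bool" where
  "chordal G \<longleftrightarrow> \<not> (\<exists>p. induced_cycle G p \<and> length p \<ge> 4)"

definition proper_coloring :: "('a, 'b) pre_digraph \<Rightarrow> ('a \<Rightarrow> nat) \<Rightarrow> bool" where
  "proper_coloring G c \<longleftrightarrow> (\<forall>x y. x \<rightarrow>\<^bsub>G\<^esub> y \<longrightarrow> c x \<noteq> c y)"

definition conflict_free :: "('a, 'b) pre_digraph \<Rightarrow> ('a \<Rightarrow> nat) \<Rightarrow> bool" where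
  "conflict_free G c \<longleftrightarrow>
     (\<forall>x \<in> verts G. open_nbhd G x \<noteq> {} \<longrightarrow> (\<exists>a. \<exists>!y. y \<in> open_nbhd G x \<and> c y = a))"

definition pcf_coloring :: "('a, 'b) pre_digraph \<Rightarrow> nat \<Rightarrow> ('a \<Rightarrow> nat) \<Rightarrow> bool" where
  "pcf_coloring G k c \<longleftrightarrow>
     card (c ` verts G) \<le> k \<and> proper_coloring G c \<and> conflict_free G c"

definition pcf_chromatic_number :: "('a, 'b) pre_digraph \<Rightarrow> nat" where
  "pcf_chromatic_number G = (LEAST k. \<exists>c. pcf_coloring G k c)"

lemma (in graph) out_degree_eq_card_open_nbhd: "out_degree G v = card (open_nbhd G v)"
proof -
  have "bij_betw (head G) (out_arcs G v) (open_nbhd G v)"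
  proof (rule bij_betw_imageI)
    show "inj_on (head G) (out_arcs G v)"
      by (rule inj_onI) (auto simp: out_arcs_def arc_to_ends_def intro!: no_multi_arcs)
    show "head G ` out_arcs G v = open_nbhd G v"
      by (force simp: open_nbhd_def out_arcs_def arcs_ends_conv)
  qed
  then show ?thesis
    unfolding out_degree_def by (rule bij_betw_same_card)
qed

text \<open>
  An injective coloring is a PCF coloring, so the minimum defining \<open>pcf_chromatic_number\<close> is over
  a nonempty set.
\<close>

lemma (in graph) ex_pcf_coloring: "\<exists>c. pcf_coloring G (card (verts G)) c"
proof -
  obtain c :: "'a \<Rightarrow> nat" where c: "inj_on c (verts G)"
    using finite_imp_inj_to_nat_seg[OF finite_verts] by blast
  have "proper_coloring G c"
    unfolding proper_coloring_def using c adj_in_verts adj_not_same by (metis inj_on_eq_iff)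
  moreover have "conflict_free G c"
    unfolding conflict_free_def
  proof (intro ballI impI)
    fix x assume "open_nbhd G x \<noteq> {}"
    then obtain y where y: "y \<in> open_nbhd G x" by blast
    have "open_nbhd G x \<subseteq> verts G" unfolding open_nbhd_def using adj_in_verts by blast
    then have "\<exists>!z. z \<in> open_nbhd G x \<and> c z = c y"
      using y c by (metis inj_on_eq_iff subsetD)
    then show "\<exists>a. \<exists>!z. z \<in> open_nbhd G x \<and> c z = a" by blast
  qed
  ultimately show ?thesis
    unfolding pcf_coloring_def using card_image_le[OF finite_verts] by blast
qed

lemma (in graph) pcf_coloring_pcf_chromatic_number:
  "\<exists>c. pcf_coloring G (pcf_chromatic_number G) c"
  unfolding pcf_chromatic_number_def by (rule LeastI_ex) (use ex_pcf_coloring in blast)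

end

theory Submission
  imports Defs
begin

text \<open>
  A chordal graph has a simplicial vertex \<open>v\<close>, that is, one whose neighbours form a clique (Dirac).
  Color \<open>G - v\<close> by induction and choose for each of its non-isolated vertices a color that is
  unique on its neighborhood. Give \<open>v\<close> a color that avoids the colors and the chosen
  unique colors of its neighbours: these are at most \<open>2\<Delta>\<close> colors. The neighbours of \<open>v\<close> keep
  their unique colors, a neighbour that was isolated now has \<open>v\<close> as its only neighbour, and the
  neighbours of \<open>v\<close> form a clique, so that each of their colors is unique around \<open>v\<close>.
\<close>

section \<open>Chordless cycles and simplicial vertices of an adjacency relation\<close>

text \<open>An induced cycle given by its vertices. Looking only at \<open>i < j\<close> suffices
  for a symmetric \<open>E\<close>; the last disjunct is the closing edge.\<close>

definition hole :: "('a \<Rightarrow> 'a \<Rightarrow> bool) \<Rightarrow> 'a list \<Rightarrow> bool" where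
  "hole E xs \<longleftrightarrow> 4 \<le> length xs \<and> distinct xs \<and>
     (\<forall>i j. i < j \<longrightarrow> j < length xs \<longrightarrow>
        (E (xs ! i) (xs ! j) \<longleftrightarrow> j = Suc i \<or> i = 0 \<and> Suc j = length xs))"

text \<open>Relative to \<open>S\<close>, so that inductions can shrink the vertex set without
  forming subgraphs.\<close>

definition simplicial :: "('a \<Rightarrow> 'a \<Rightarrow> bool) \<Rightarrow> 'a set \<Rightarrow> 'a \<Rightarrow> bool" where
  "simplicial E S z \<longleftrightarrow> (\<forall>x\<in>S. \<forall>y\<in>S. E z x \<longrightarrow> E z y \<longrightarrow> x \<noteq> y \<longrightarrow> E x y)"

lemma simplicial_if_complete:
  assumes "\<forall>x\<in>S. \<forall>y\<in>S. y \<noteq> x \<longrightarrow> E x y"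
  shows "simplicial E S z"
  unfolding simplicial_def
proof (intro ballI impI)
  fix x y assume "x \<in> S" "y \<in> S" "x \<noteq> y"
  then show "E x y" using assms by simp
qed

text \<open>Serves to exclude chords of a shortest walk: the result is strictly shorter as soon as
  \<open>j\<close> exceeds \<open>Suc i\<close>.\<close>

lemma successively_shortcut:
  assumes "successively E ws" "i < j" "j < length ws" "E (ws ! i) (ws ! j)"
  shows "successively E (take (Suc i) ws @ drop j ws)"
proof -
  have "successively E (take (Suc i) ws)" "successively E (drop j ws)"
    using assms(1) successively_append_iff append_take_drop_id by metis+
  moreover have "last (take (Suc i) ws) = ws ! i" "hd (drop j ws) = ws ! j"
    using assms by (auto simp: take_Suc_conv_app_nth hd_drop_conv_nth)
  ultimately show ?thesis
    using assms by (simp add: successively_append_iff)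
qed

lemma successively_join:
  assumes "successively E (xs @ [u])" "successively E (u # ys)"
  shows "successively E (xs @ u # ys)"
  using assms by (auto simp: successively_append_iff)

section \<open>Dirac's theorem: simplicial vertices in the absence of holes\<close>

locale hole_free =
  fixes E :: "'a \<Rightarrow> 'a \<Rightarrow> bool"
  assumes sym: "E x y \<Longrightarrow> E y x"
    and irrefl: "\<not> E x x"
    and no_hole: "\<not> hole E xs"
begin

text \<open>
  A shortest walk from \<open>a\<close> to \<open>b\<close> with interior in \<open>D\<close> would close up to a hole through \<open>v\<close>.
\<close>

lemma common_neighbours_adjacent:
  assumes D: "v \<notin> D" "\<And>x. x \<in> D \<Longrightarrow> \<not> E v x"
    and ab: "E v a" "E v b" "a \<noteq> b"
    and walk: "set ys \<subseteq> D" "successively E (a # ys @ [b])"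
  shows "E a b"
proof (rule ccontr)
  assume nab: "\<not> E a b"
  define W where "W = (\<lambda>xs. set xs \<subseteq> D \<and> successively E (a # xs @ [b]))"
  have "W ys" using walk by (simp add: W_def)
  then obtain xs where xs: "W xs" and least: "\<And>zs. W zs \<Longrightarrow> length xs \<le> length zs"
    using ex_has_least_nat[of W ys length] by blast
  define ws where "ws = a # xs @ [b]"
  have ws: "successively E ws" "set xs \<subseteq> D" using xs by (auto simp: W_def ws_def)
  have chordless: "E (ws ! i) (ws ! j) \<longleftrightarrow> j = Suc i" if ij: "i < j" "j < length ws" for i j
  proof
    assume e: "E (ws ! i) (ws ! j)"
    show "j = Suc i"
    proof (rule ccontr)
      assume "j \<noteq> Suc i"
      \<comment> \<open>Since \<open>ws\<close> has \<open>a\<close> in front, position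
        \<open>j\<close> of \<open>ws\<close> is position \<open>k\<close> of
        \<open>xs @ [b]\<close>. The shortcut drops \<open>k - i\<close> interior vertices, hence at
        least one.\<close>
      then obtain k where k: "j = Suc k" "i < k" using ij by (cases j) auto
      have "k \<le> length xs" using ij k by (simp add: ws_def)
      then have "take (Suc i) ws @ drop j ws = a # (take i xs @ drop k xs) @ [b]"
        using k by (simp add: ws_def)
      with successively_shortcut[OF ws(1) ij e]
      have "successively E (a # (take i xs @ drop k xs) @ [b])" by simp
      then have "W (take i xs @ drop k xs)"
        using ws(2) set_take_subset[of i xs] set_drop_subset[of k xs] unfolding W_def by auto
      from least[OF this] \<open>k \<le> length xs\<close> \<open>i < k\<close> show False by auto
    qed
  next
    assume "j = Suc i"
    then show "E (ws ! i) (ws ! j)" using ws(1) ij by (simp add: successively_conv_nth)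
  qed
  \<comment> \<open>Otherwise the closed stretch between two visits to a vertex \<open>y\<close>
    could be cut out.\<close>
  have "distinct xs"
  proof (rule ccontr)
    assume "\<not> distinct xs"
    then obtain p y q r where d: "xs = p @ [y] @ q @ [y] @ r" using not_distinct_decomp by blast
    have "successively E (((a # p) @ [y]) @ q @ y # r @ [b])"
      and "successively E ((a # p @ y # q) @ y # r @ [b])"
      using xs unfolding W_def d by simp_all
    then have "successively E ((a # p) @ [y])" "successively E (y # r @ [b])"
      by (simp_all only: successively_append_iff)
    then have "successively E ((a # p) @ y # r @ [b])" by (rule successively_join)
    then have "W (p @ [y] @ r)" using xs unfolding W_def d by simp
    from least[OF this] d show False by simp
  qed
  then have dist: "distinct (v # ws)"
    using D ab irrefl ws(2) by (auto simp: ws_def)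
  \<comment> \<open>An empty interior would make \<open>a\<close> and \<open>b\<close> adjacent.
    Together with \<open>v\<close>, \<open>a\<close> and \<open>b\<close> this gives the four
    vertices that a hole needs.\<close>
  have "xs \<noteq> []" using ws nab by (auto simp: ws_def)
  have v: "E v (ws ! k) \<longleftrightarrow> k = 0 \<or> Suc k = length ws" if "k < length ws" for k
    using that ab D(2) ws(2) nth_mem[of _ xs]
    by (auto simp: ws_def nth_Cons nth_append subset_iff split: nat.splits if_splits)
  have "hole E (v # ws)"
    unfolding hole_def
  proof (intro conjI allI impI)
    show "4 \<le> length (v # ws)" using \<open>xs \<noteq> []\<close> by (cases xs) (auto simp: ws_def)
    show "distinct (v # ws)" by (rule dist)
    fix i j assume ij: "i < j" "j < length (v # ws)"
    then obtain k where k: "j = Suc k" "k < length ws" by (cases j) auto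
    show "E ((v # ws) ! i) ((v # ws) ! j) \<longleftrightarrow> j = Suc i \<or> i = 0 \<and> Suc j = length (v # ws)"
    proof (cases i)
      case 0
      then show ?thesis using k v by auto
    next
      case (Suc m)
      then show ?thesis using k ij chordless[of m k] by simp
    qed
  qed
  then show False using no_hole by blast
qed

text \<open>
  \<open>C\<close> is the component of \<open>u\<close> among the non-neighbours of \<open>v\<close>, and its boundary \<open>N\<close> is a clique.
  A vertex of \<open>C\<close> that is simplicial in \<open>C \<union> N\<close> is simplicial in \<open>S\<close>, so the induction applies to
  \<open>C \<union> N\<close>, with a vertex of \<open>N\<close> in the role of \<open>v\<close> whenever possible.
\<close>

lemma ex_simplicial_nonadjacent:
  assumes "finite S" "v \<in> S" "u \<in> S" "u \<noteq> v" "\<not> E v u"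
  shows "\<exists>z\<in>S. z \<noteq> v \<and> \<not> E v z \<and> simplicial E S z"
  using assms
proof (induction "card S" arbitrary: S u v rule: less_induct)
  case less
  define D where "D = {x\<in>S. x \<noteq> v \<and> \<not> E v x}"
  define C where "C = {last (u # ys) | ys. set ys \<subseteq> D \<and> successively E (u # ys)}"
  define N where "N = {x\<in>S. E v x \<and> (\<exists>y\<in>C. E x y)}"
  have uD: "u \<in> D" using less by (simp add: D_def)
  then have CD: "C \<subseteq> D"
    using last_in_set unfolding C_def by (auto simp: subset_iff)
  have "u \<in> C" unfolding C_def by (auto intro!: exI[of _ "[]"])
  \<comment> \<open>A neighbour of \<open>v\<close> falls into \<open>N\<close>; any other
    \<open>y\<close> prolongs the walk from \<open>u\<close> to \<open>x\<close> by one step within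
    \<open>D\<close>.\<close>
  have closed: "y \<in> C \<union> N" if "x \<in> C" "E x y" "y \<in> S" for x y
  proof (cases "E v y")
    case True
    then show ?thesis using that sym by (auto simp: N_def)
  next
    case False
    obtain ys where ys: "x = last (u # ys)" "set ys \<subseteq> D" "successively E (u # ys)"
      using \<open>x \<in> C\<close> unfolding C_def by blast
    have "y \<noteq> v" using that CD sym by (auto simp: D_def)
    then have "y \<in> D" using False that by (simp add: D_def)
    moreover have "successively E (u # (ys @ [y]))"
      using ys that by (auto simp: successively_append_iff successively_Cons split: if_splits)
    ultimately have "last (u # (ys @ [y])) \<in> C" using ys unfolding C_def
      by (intro CollectI exI[of _ "ys @ [y]"]) auto
    then show ?thesis by simp
  qed
  \<comment> \<open>Both \<open>a\<close> and \<open>b\<close> have walks through \<open>D\<close>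
    to \<open>u\<close>; reversing one of them and joining the two at \<open>u\<close> yields the
    walk for \<open>common_neighbours_adjacent\<close>.\<close>
  have N_clique: "E a b" if "a \<in> N" "b \<in> N" "a \<noteq> b" for a b
  proof -
    obtain ys where ys: "E a (last (u # ys))" "set ys \<subseteq> D" "successively E (u # ys)"
      using \<open>a \<in> N\<close> unfolding N_def C_def by blast
    obtain zs where zs: "E b (last (u # zs))" "set zs \<subseteq> D" "successively E (u # zs)"
      using \<open>b \<in> N\<close> unfolding N_def C_def by blast
    have "successively E (rev (u # ys))"
      using ys(3) sym by (subst successively_rev) (auto elim: successively_mono)
    then have "successively E (a # rev (u # ys))"
      using ys(1) by (simp add: successively_Cons hd_rev del: rev.simps last.simps)
    moreover have "successively E ((u # zs) @ [b])"
      using zs sym by (simp only: successively_append_iff) auto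
    ultimately have walk: "successively E (a # (rev ys @ u # zs) @ [b])"
      using successively_join[of E "a # rev ys" u "zs @ [b]"] by simp
    have set: "set (rev ys @ u # zs) \<subseteq> D" using ys zs uD by auto
    have D: "v \<notin> D" "\<And>x. x \<in> D \<Longrightarrow> \<not> E v x" by (simp_all add: D_def)
    have ab: "E v a" "E v b" using that by (simp_all add: N_def)
    show ?thesis by (rule common_neighbours_adjacent[OF D ab \<open>a \<noteq> b\<close> set walk])
  qed
  define H where "H = C \<union> N"
  have HS: "H \<subseteq> S" using CD by (auto simp: H_def D_def N_def)
  \<comment> \<open>Leaving out \<open>v\<close> makes \<open>H\<close> strictly smaller than
    \<open>S\<close>, as the induction requires.\<close>
  have "v \<notin> H" using CD irrefl by (auto simp: H_def D_def N_def)
  then have card: "card H < card S" using HS less.prems by (metis psubset_card_mono psubsetI)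
  have finH: "finite H" using HS less.prems finite_subset by blast
  have lift: ?case if "z \<in> C" "simplicial E H z" for z
  proof -
    have "simplicial E S z"
      using that closed unfolding simplicial_def H_def by blast
    then show ?thesis using that CD by (auto simp: D_def)
  qed
  have ex: "\<exists>z\<in>H. z \<noteq> w \<and> \<not> E w z \<and> simplicial E H z"
    if "w \<in> H" "x \<in> H" "x \<noteq> w" "\<not> E w x" for w x
    using less.hyps[OF card finH that] .
  \<comment> \<open>\<open>lift\<close> needs the vertex \<open>z\<close> from \<open>ex\<close> to
    lie in \<open>C\<close>. In case \<open>N\<close>, \<open>z\<close> is not adjacent to
    \<open>w\<close>, so it lies outside the clique \<open>N\<close>. In case \<open>C\<close>,
    every vertex of \<open>N\<close> is adjacent to \<open>w\<close>, so again \<open>z\<close> is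
    not in \<open>N\<close>. In the last case \<open>u\<close> itself serves.\<close>
  consider (N) w x where "w \<in> N" "x \<in> H" "x \<noteq> w" "\<not> E w x"
    | (C) w x where "w \<in> C" "x \<in> H" "x \<noteq> w" "\<not> E w x" "\<forall>w\<in>N. \<forall>x\<in>H. x \<noteq> w \<longrightarrow> E w x"
    | (complete) "\<forall>w\<in>H. \<forall>x\<in>H. x \<noteq> w \<longrightarrow> E w x"
    unfolding H_def by blast
  then show ?case
  proof cases
    case N
    then obtain z where z: "z \<in> H" "z \<noteq> w" "\<not> E w z" "simplicial E H z" using ex H_def by blast
    then show ?thesis using lift N N_clique by (auto simp: H_def)
  next
    case C
    then obtain z where z: "z \<in> H" "z \<noteq> w" "\<not> E w z" "simplicial E H z" using ex H_def by blast
    moreover have "z \<notin> N"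
    proof
      assume "z \<in> N"
      then have "E z w" using C(1,5) z(2) by (auto simp: H_def)
      then show False using z(3) sym by blast
    qed
    ultimately show ?thesis using lift by (auto simp: H_def)
  next
    case complete
    then have "simplicial E H u" by (rule simplicial_if_complete)
    with \<open>u \<in> C\<close> show ?thesis by (rule lift)
  qed
qed

lemma ex_simplicial:
  assumes "finite S" "S \<noteq> {}"
  shows "\<exists>z\<in>S. simplicial E S z"
proof (cases "\<exists>v\<in>S. \<exists>u\<in>S. u \<noteq> v \<and> \<not> E v u")
  case True
  then show ?thesis using ex_simplicial_nonadjacent[OF assms(1)] by blast
next
  case False
  then have "simplicial E S z" for z by (intro simplicial_if_complete) blast
  then show ?thesis using assms(2) by blast
qed

section \<open>Coloring by adding simplicial vertices one at a time\<close>

text \<open>The bound \<open>d\<close> stays fixed while \<open>S\<close> shrinks, since deleting a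
  vertex raises no degree. There are \<open>2 * d + 1\<close> colors, one more than can be forbidden
  at a new vertex.\<close>

lemma ex_pcf_coloring_on:
  assumes "finite S" "\<And>x. x \<in> S \<Longrightarrow> card {y\<in>S. E x y} \<le> d"
  shows "\<exists>c. c ` S \<subseteq> {..2 * d} \<and> (\<forall>x\<in>S. \<forall>y\<in>S. E x y \<longrightarrow> c x \<noteq> c y) \<and>
    (\<forall>x\<in>S. (\<exists>y\<in>S. E x y) \<longrightarrow> (\<exists>a::nat. \<exists>!y. y \<in> S \<and> E x y \<and> c y = a))"
  using assms
proof (induction "card S" arbitrary: S)
  case 0
  then show ?case by auto
next
  case (Suc n)
  then obtain v where v: "v \<in> S" "simplicial E S v" using ex_simplicial[of S] by fastforce
  define T where "T = S - {v}"
  have S: "S = insert v T" "v \<notin> T" "finite T" using v Suc.prems by (auto simp: T_def)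
  have "card {y\<in>T. E x y} \<le> d" if "x \<in> T" for x
    using Suc.prems(2)[of x] that Suc.prems(1) S
      card_mono[of "{y\<in>S. E x y}" "{y\<in>T. E x y}"] by fastforce
  moreover have "n = card T" using Suc.hyps(2) S by simp
  ultimately obtain c where c: "c ` T \<subseteq> {..2 * d}" "\<forall>x\<in>T. \<forall>y\<in>T. E x y \<longrightarrow> c x \<noteq> c y"
    "\<forall>x\<in>T. (\<exists>y\<in>T. E x y) \<longrightarrow> (\<exists>a::nat. \<exists>!y. y \<in> T \<and> E x y \<and> c y = a)"
    using Suc.hyps(1)[of T] S(3) by blast
  \<comment> \<open>With the quantifier over colors in front of the implication,
    \<open>bchoice\<close> applies to all of \<open>T\<close>; at vertices isolated in
    \<open>T\<close> the value of \<open>w\<close> is arbitrary.\<close>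
  have "\<forall>x\<in>T. \<exists>a::nat. (\<exists>y\<in>T. E x y) \<longrightarrow> (\<exists>!y. y \<in> T \<and> E x y \<and> c y = a)"
    using c(3) by blast
  from bchoice[OF this] obtain w where
    w: "\<And>x. x \<in> T \<Longrightarrow> \<exists>y\<in>T. E x y \<Longrightarrow> \<exists>!y. y \<in> T \<and> E x y \<and> c y = w x"
    by blast
  define N where "N = {y\<in>S. E v y}"
  have N: "finite N" "card N \<le> d" "N \<subseteq> T"
    using Suc.prems v irrefl S by (auto simp: N_def)
  have "card (c ` N \<union> w ` N) \<le> card N + card N"
    using card_Un_le[of "c ` N" "w ` N"] card_image_le[OF N(1), of c] card_image_le[OF N(1), of w]
    by linarith
  then have "card (c ` N \<union> w ` N) < card {..2 * d}" using N(2) by simp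
  then have "\<not> {..2 * d} \<subseteq> c ` N \<union> w ` N"
    using N(1) by (meson card_mono finite_UnI finite_imageI not_le)
  then obtain a where a: "a \<le> 2 * d" "a \<notin> c ` N" "a \<notin> w ` N" by auto
  define f where "f = c(v := a)"
  have f: "f v = a" "\<And>x. x \<in> T \<Longrightarrow> f x = c x" using S by (auto simp: f_def)
  have "f ` S \<subseteq> {..2 * d}" using c(1) a(1) f S(1) by auto
  moreover have "f x \<noteq> f y" if xy: "x \<in> S" "y \<in> S" "E x y" for x y
  proof -
    consider "x = v" "y \<in> N" | "y = v" "x \<in> N" | "x \<in> T" "y \<in> T"
      using xy S(1) sym[of x y] unfolding N_def by blast
    then show ?thesis
    proof cases
      case 1
      then have "f y = c y" "c y \<noteq> a" using f(2) N(3) a(2) by blast+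
      then show ?thesis using 1 f(1) by simp
    next
      case 2
      then have "f x = c x" "c x \<noteq> a" using f(2) N(3) a(2) by blast+
      then show ?thesis using 2 f(1) by simp
    next
      case 3
      then show ?thesis using f(2) c(2) xy by simp
    qed
  qed
  moreover have "\<exists>b. \<exists>!y. y \<in> S \<and> E x y \<and> f y = b" if x: "x \<in> S" "\<exists>y\<in>S. E x y" for x
  proof (cases "x = v")
    case True
    then obtain y where y: "y \<in> N" using x by (auto simp: N_def)
    have "z = y" if "z \<in> N" "f z = f y" for z
    proof (rule ccontr)
      assume "z \<noteq> y"
      then have "E z y" using that y v(2) unfolding simplicial_def N_def by blast
      moreover have "z \<in> T" "y \<in> T" using that(1) y N(3) by blast+
      ultimately show False using c(2) that(2) f(2)[of z] f(2)[of y] by auto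
    qed
    then have "\<exists>!z. z \<in> S \<and> E x z \<and> f z = f y" using True y by (auto simp: N_def)
    then show ?thesis by blast
  next
    case False
    then have xT: "x \<in> T" using x S by auto
    show ?thesis
    proof (cases "\<exists>y\<in>T. E x y")
      case True
      \<comment> \<open>By symmetry \<open>x\<close> lies in \<open>N\<close>, where
        \<open>a\<close> avoids the values of \<open>w\<close>; so \<open>v\<close> is no second
        neighbour of color \<open>w x\<close>.\<close>
      have "f v \<noteq> w x" if "E x v"
        using that a(3) x(1) sym f(1) by (auto simp: N_def)
      then have "y \<in> S \<and> E x y \<and> f y = w x \<longleftrightarrow> y \<in> T \<and> E x y \<and> c y = w x" for y
        using S f by auto
      then have "\<exists>!y. y \<in> S \<and> E x y \<and> f y = w x" using w[OF xT True] by simp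
      then show ?thesis by blast
    next
      case False
      then have "y \<in> S \<and> E x y \<longleftrightarrow> y = v" for y using x S(1) by blast
      then have "\<exists>!y. y \<in> S \<and> E x y \<and> f y = a" using f(1) by metis
      then show ?thesis by blast
    qed
  qed
  ultimately show ?case by (intro exI[of _ f]) blast
qed

end

section \<open>From vertex lists to cycles of arcs\<close>

context graph begin

text \<open>The choice is unique on adjacent pairs, as there are no parallel arcs.\<close>

definition arc_of :: "'a \<Rightarrow> 'a \<Rightarrow> 'b" where
  "arc_of x y = (SOME e. e \<in> arcs G \<and> tail G e = x \<and> head G e = y)"

lemma arc_of:
  assumes "x \<rightarrow>\<^bsub>G\<^esub> y"
  shows "arc_of x y \<in> arcs G" "tail G (arc_of x y) = x" "head G (arc_of x y) = y"
proof -
  have "\<exists>e. e \<in> arcs G \<and> tail G e = x \<and> head G e = y"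
    using assms by (auto simp: arcs_ends_conv)
  then show "arc_of x y \<in> arcs G" "tail G (arc_of x y) = x" "head G (arc_of x y) = y"
    unfolding arc_of_def by (rule someI2_ex, simp)+
qed

text \<open>\<open>map2\<close> stops at the shorter list and thus pairs each vertex with its
  successor. The list of visited vertices is recorded because \<open>cycle\<close> asks for
  distinctness.\<close>

lemma awalk_map2_arc_of:
  assumes "x \<in> verts G" "successively (\<lambda>x y. x \<rightarrow>\<^bsub>G\<^esub> y) (x # ys)"
  shows "awalk x (map2 arc_of (x # ys) ys) (last (x # ys)) \<and>
    awalk_verts x (map2 arc_of (x # ys) ys) = x # ys"
  using assms
proof (induction ys arbitrary: x)
  case Nil
  then show ?case by (simp add: awalk_Nil_iff)
next
  case (Cons y ys)
  then have "x \<rightarrow>\<^bsub>G\<^esub> y" "y \<in> verts G" by (auto simp: adj_in_verts)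
  then show ?case using Cons arc_of[of x y] by (auto simp: awalk_Cons_iff)
qed

text \<open>Lets \<open>chordal\<close>, which speaks of arcs, supply the assumption
  \<open>no_hole\<close>, which speaks of vertices.\<close>

lemma induced_cycle_of_hole:
  assumes "hole (\<lambda>x y. x \<rightarrow>\<^bsub>G\<^esub> y) xs"
  shows "\<exists>p. induced_cycle G p \<and> length p = length xs"
proof -
  define n where "n = length xs"
  \<comment> \<open>\<open>rotate1 xs\<close> lists the cyclic successors, so the last arc closes
    the cycle.\<close>
  define p where "p = map2 arc_of xs (rotate1 xs)"
  have n: "4 \<le> n" "distinct xs"
    and adj: "\<And>i j. i < j \<Longrightarrow> j < n \<Longrightarrow>
      xs ! i \<rightarrow>\<^bsub>G\<^esub> xs ! j \<longleftrightarrow> j = Suc i \<or> i = 0 \<and> Suc j = n"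
    using assms unfolding hole_def n_def by auto
  have len: "length p = n" by (simp add: p_def n_def)
  have rot: "rotate1 xs ! i = xs ! (Suc i mod n)" if "i < n" for i
    using that by (simp add: nth_rotate1 n_def)
  have step: "xs ! i \<rightarrow>\<^bsub>G\<^esub> rotate1 xs ! i" if "i < n" for i
  proof (cases "Suc i = n")
    case True
    \<comment> \<open>\<open>adj\<close> gives the closing edge only from position 0 to the last
      one; symmetry of the arcs turns it around.\<close>
    have "xs ! 0 \<rightarrow>\<^bsub>G\<^esub> xs ! i" using True n adj[of 0 i] by auto
    then show ?thesis using True rot[OF that] arcs_ends_symmetric[OF sym_arcs] by simp
  next
    case False
    then show ?thesis using that adj[of i "Suc i"] rot[OF that] by simp
  qed
  have p: "tail G (p ! i) = xs ! i" "head G (p ! i) = rotate1 xs ! i" if "i < n" for i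
    using arc_of[OF step[OF that]] that by (simp_all add: p_def n_def)
  obtain x ys where xs: "xs = x # ys" using n n_def by (cases xs) auto
  have p': "p = map2 arc_of (x # (ys @ [x])) (ys @ [x])"
    unfolding p_def xs by (simp add: zip_append1 flip: append_Cons)
  have "successively (\<lambda>x y. x \<rightarrow>\<^bsub>G\<^esub> y) (x # (ys @ [x]))"
    unfolding successively_conv_nth
  proof (intro allI impI)
    fix i assume "Suc i < length (x # (ys @ [x]))"
    then have "i < n" by (simp add: n_def xs)
    moreover from this have "(x # (ys @ [x])) ! i = xs ! i"
      by (simp add: n_def xs nth_append flip: append_Cons)
    ultimately show "(x # (ys @ [x])) ! i \<rightarrow>\<^bsub>G\<^esub> (x # (ys @ [x])) ! Suc i"
      using step[of i] by (simp add: xs)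
  qed
  moreover have "x \<in> verts G" using step[of 0] n xs adj_in_verts by auto
  ultimately have "awalk x p x" "awalk_verts x p = x # (ys @ [x])"
    using awalk_map2_arc_of[of x "ys @ [x]"] p' by auto
  \<comment> \<open>Only the tail of the vertex list has to be distinct: it is
    \<open>ys @ [x]\<close>, a rotation of \<open>xs\<close>.\<close>
  then have "cycle p"
    unfolding cycle_def using n len xs by (intro exI[of _ x]) auto
  moreover have "tail G ` set p = set xs"
  proof -
    have "map (tail G) p = xs" using p len by (intro nth_equalityI) (auto simp: n_def)
    then show ?thesis by (metis set_map)
  qed
  moreover have "\<exists>e'\<in>set p. {tail G e, head G e} = {tail G e', head G e'}"
    if e: "e \<in> arcs G" "tail G e \<in> set xs" "head G e \<in> set xs" for e
  proof -
    obtain i where i: "i < n" "xs ! i = tail G e"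
      using e(2) unfolding in_set_conv_nth n_def by blast
    obtain j where j: "j < n" "xs ! j = head G e"
      using e(3) unfolding in_set_conv_nth n_def by blast
    have ends: "xs ! i \<rightarrow>\<^bsub>G\<^esub> xs ! j"
      unfolding i j using e(1) by (rule in_arcs_imp_in_arcs_ends)
    \<comment> \<open>Of two opposite arcs \<open>p\<close> contains only one, so ends are compared
      as unordered pairs; this also reduces the claim to \<open>i < j\<close>.\<close>
    have *: "\<exists>e'\<in>set p. {xs ! i, xs ! j} = {tail G e', head G e'}"
      if ij: "i < j" "j < n" and e: "xs ! i \<rightarrow>\<^bsub>G\<^esub> xs ! j" for i j
    proof -
      consider "j = Suc i" | "i = 0" "Suc j = n" using adj ij e by blast
      then show ?thesis
      proof cases
        case 1
        then show ?thesis
          using ij p[of i] rot[of i] len by (intro bexI[of _ "p ! i"]) auto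
      next
        case 2
        then show ?thesis
          using ij p[of j] rot[of j] len by (intro bexI[of _ "p ! j"]) auto
      qed
    qed
    have "i \<noteq> j" using ends adj_not_same by blast
    then consider "i < j" | "j < i" by linarith
    then show ?thesis
    proof cases
      case 1
      then show ?thesis using *[of i j] ends i j by simp
    next
      case 2
      then show ?thesis using *[of j i] arcs_ends_symmetric[OF sym_arcs ends] i j
        by (simp add: insert_commute)
    qed
  qed
  ultimately have "induced_cycle G p"
    unfolding induced_cycle_def by auto
  then show ?thesis using len n_def by blast
qed

end

theorem proposition3p4:
  fixes G :: "('a, 'b) pre_digraph" and \<Delta> :: nat
  assumes "graph G" and "chordal G" and "max_degree G = \<Delta>"
  shows "pcf_chromatic_number G \<le> 2 * \<Delta> + 1"
proof -
  interpret graph G by fact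
  let ?E = "\<lambda>x y. x \<rightarrow>\<^bsub>G\<^esub> y"
  interpret hole_free ?E
  proof
    show "?E y x" if "?E x y" for x y using that arcs_ends_symmetric[OF sym_arcs] by blast
    show "\<not> ?E x x" for x using adj_not_same by blast
    show "\<not> hole ?E xs" for xs
      using induced_cycle_of_hole[of xs] assms(2) unfolding chordal_def hole_def by metis
  qed
  \<comment> \<open>Arcs end in vertices, so for \<open>S = verts G\<close> the relativized
    neighbourhoods are the full ones.\<close>
  have nbhd: "{y \<in> verts G. ?E x y} = open_nbhd G x" for x
    using adj_in_verts by (auto simp: open_nbhd_def)
  have "card {y \<in> verts G. ?E x y} \<le> \<Delta>" if "x \<in> verts G" for x
    using that assms(3) unfolding nbhd max_degree_def
    by (auto simp flip: out_degree_eq_card_open_nbhd)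
  from ex_pcf_coloring_on[OF finite_verts this] obtain c where c: "c ` verts G \<subseteq> {..2 * \<Delta>}"
    "\<forall>x\<in>verts G. \<forall>y\<in>verts G. ?E x y \<longrightarrow> c x \<noteq> c y"
    "\<forall>x\<in>verts G. (\<exists>y\<in>verts G. ?E x y) \<longrightarrow> (\<exists>a. \<exists>!y. y \<in> verts G \<and> ?E x y \<and> c y = a)"
    by blast
  have "card (c ` verts G) \<le> 2 * \<Delta> + 1" using card_mono[OF _ c(1)] by simp
  moreover have "proper_coloring G c"
    using c(2) adj_in_verts unfolding proper_coloring_def by blast
  moreover have "conflict_free G c"
    unfolding conflict_free_def
  proof (intro ballI impI)
    fix x assume "x \<in> verts G" "open_nbhd G x \<noteq> {}"
    then have "\<exists>a. \<exists>!y. y \<in> verts G \<and> ?E x y \<and> c y = a"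
      using c(3) nbhd[of x] by blast
    moreover have "y \<in> verts G \<and> ?E x y \<and> c y = a \<longleftrightarrow> y \<in> open_nbhd G x \<and> c y = a" for y a
      using nbhd[of x] by blast
    ultimately show "\<exists>a. \<exists>!y. y \<in> open_nbhd G x \<and> c y = a" by simp
  qed
  ultimately have "pcf_coloring G (2 * \<Delta> + 1) c"
    unfolding pcf_coloring_def by blast
  then show ?thesis
    unfolding pcf_chromatic_number_def by (intro Least_le) blast
qed

end
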